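(* A retract of a $c$-well-filtered space is $c$-well-filtered. That is, if $X$ is a $c$-well-filtered topological space, $Y$ is a topological space, and there are continuous maps $r:X\to Y$ and $s:Y\to X$ with $r\circ s=\mathrm{id}_Y$, then $Y$ is $c$-well-filtered.
   Context: A subset of a topological space is saturated if it is an intersection of open sets (equivalently, an upper set for the specialization order $x\le y\iff x\in\mathrm{cl}(\{y\})$). A subset $A$ is a Lindelöf set if every open cover of $A$ has a countable subcover. A nonempty family of sets is countably filtered if for every countable subfamily there is a member of the family contained in every member of the subfamily. A topological space $X$ is $c$-well-filtered if for every countably filtered family $\{K_i\}_{i\in I}$ of saturated Lindelöf subsets of $X$ and each open $U$ with $\bigcap_{i\in I}K_i\subseteq U$, there is $i_0\in I$ with $K_{i_0}\subseteq U$. *)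

theory Defs
  imports "HOL-Analysis.Analysis"
begin

text \<open>The intersection with the carrier only matters for the empty family, whose intersection
  is the whole space.\<close>

definition saturated_in :: "'a topology \<Rightarrow> 'a set \<Rightarrow> bool"
  where "saturated_in X S \<longleftrightarrow>
           (\<exists>\<U>. (\<forall>U \<in> \<U>. openin X U) \<and> S = topspace X \<inter> \<Inter>\<U>)"

definition Lindelofin :: "'a topology \<Rightarrow> 'a set \<Rightarrow> bool"
  where "Lindelofin X S \<longleftrightarrow>
           S \<subseteq> topspace X \<and>
           (\<forall>\<U>. (\<forall>U \<in> \<U>. openin X U) \<and> S \<subseteq> \<Union>\<U>
             \<longrightarrow> (\<exists>\<V>. countable \<V> \<and> \<V> \<subseteq> \<U> \<and> S \<subseteq> \<Union>\<V>))"

lemma Lindelofin_iff_Lindelof_space_subtopology: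
  "Lindelofin X S \<longleftrightarrow> S \<subseteq> topspace X \<and> Lindelof_space (subtopology X S)"
  unfolding Lindelofin_def using Lindelof_space_subtopology_subset[of S X] by blast

definition countably_filtered :: "'a set set \<Rightarrow> bool"
  where "countably_filtered \<K> \<longleftrightarrow>
           \<K> \<noteq> {} \<and> (\<forall>\<C>. countable \<C> \<and> \<C> \<subseteq> \<K> \<longrightarrow> (\<exists>K \<in> \<K>. \<forall>C \<in> \<C>. K \<subseteq> C))"

text \<open>Indexed families are replaced by their ranges: all conditions depend only on the set of
  members.\<close>

definition c_well_filtered :: "'a topology \<Rightarrow> bool"
  where "c_well_filtered X \<longleftrightarrow>
           (\<forall>\<K> U. countably_filtered \<K> \<and> (\<forall>K \<in> \<K>. saturated_in X K \<and> Lindelofin X K) \<and>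
                  openin X U \<and> \<Inter>\<K> \<subseteq> U
             \<longrightarrow> (\<exists>K \<in> \<K>. K \<subseteq> U))"

lemma saturated_in_iff_upper_specialization:
  "saturated_in X S \<longleftrightarrow>
     S \<subseteq> topspace X \<and> (\<forall>x \<in> S. \<forall>y \<in> topspace X. x \<in> X closure_of {y} \<longrightarrow> y \<in> S)"
  (is "?L \<longleftrightarrow> ?R")
proof
  assume ?L
  then obtain \<U> where \<U>: "\<And>U. U \<in> \<U> \<Longrightarrow> openin X U" and S: "S = topspace X \<inter> \<Inter>\<U>"
    unfolding saturated_in_def by blast
  have "y \<in> U" if "x \<in> S" "x \<in> X closure_of {y}" "U \<in> \<U>" for x y U
  proof -
    have "x \<in> U" "openin X U" using that S \<U> by auto
    then show ?thesis using that(2) unfolding in_closure_of by blast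
  qed
  then show ?R unfolding S by blast
next
  assume R: ?R
  have "S = topspace X \<inter> \<Inter>{U. openin X U \<and> S \<subseteq> U}"
  proof
    show "topspace X \<inter> \<Inter>{U. openin X U \<and> S \<subseteq> U} \<subseteq> S"
    proof (rule subsetI, rule ccontr)
      fix y assume y: "y \<in> topspace X \<inter> \<Inter>{U. openin X U \<and> S \<subseteq> U}" and "y \<notin> S"
      let ?U = "topspace X - X closure_of {y}"
      have "S \<subseteq> ?U" using R y \<open>y \<notin> S\<close> by blast
      moreover have "openin X ?U" by (simp add: openin_diff)
      ultimately have "y \<in> ?U" using y by blast
      then show False using y by (auto simp: in_closure_of)
    qed
  qed (use R in auto)
  then show ?L
    unfolding saturated_in_def by (intro exI[of _ "{U. openin X U \<and> S \<subseteq> U}"] conjI) simp_all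
qed

end

theory Submission
  imports Defs
begin

text \<open>A family of saturated Lindelof sets in the retract \<open>Y\<close> is pushed into \<open>X\<close> by sending
  \<open>K\<close> to the saturation of \<open>s ` K\<close>, that is, to the intersection of its open neighbourhoods.
  Continuous images and saturations of Lindelof sets are Lindelof
  (\<open>Lindelofin_continuous_map_image\<close>, \<open>Lindelofin_saturation\<close>), and the assignment is monotone, so it
  keeps countable filteredness (\<open>countably_filtered_image\<close>). The key point is that \<open>r\<close> maps the
  saturation of \<open>s ` K\<close> back into \<open>K\<close>: an open \<open>V\<close> containing \<open>K\<close> has an open preimage
  under \<open>r\<close> that contains \<open>s ` K\<close>, hence its saturation, and \<open>K\<close> is the intersection of
  such \<open>V\<close> (\<open>saturation_section_image\<close>). So if the members of the given family meet inside an open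
  \<open>U\<close>, their counterparts in \<open>X\<close> meet inside the preimage of \<open>U\<close>; one counterpart lies in
  that preimage by hypothesis, and applying \<open>r \<circ> s = id\<close> to it puts the corresponding \<open>K\<close>
  inside \<open>U\<close>.\<close>

definition saturation :: "'a topology \<Rightarrow> 'a set \<Rightarrow> 'a set"
  where "saturation X S = topspace X \<inter> \<Inter>{U. openin X U \<and> S \<subseteq> U}"

lemma saturation_subset_iff:
  assumes "openin X U" "S \<subseteq> topspace X"
  shows "saturation X S \<subseteq> U \<longleftrightarrow> S \<subseteq> U"
  using assms unfolding saturation_def by blast

lemma saturation_mono: "S \<subseteq> T \<Longrightarrow> saturation X S \<subseteq> saturation X T"
  unfolding saturation_def by blast

lemma saturated_in_saturation: "saturated_in X (saturation X S)"
  unfolding saturated_in_def saturation_def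
  by (intro exI[of _ "{U. openin X U \<and> S \<subseteq> U}"]) simp

lemma LindelofinI:
  assumes "S \<subseteq> topspace X"
    and "\<And>\<U>. \<forall>U \<in> \<U>. openin X U \<Longrightarrow> S \<subseteq> \<Union>\<U>
           \<Longrightarrow> \<exists>\<V>. countable \<V> \<and> \<V> \<subseteq> \<U> \<and> S \<subseteq> \<Union>\<V>"
  shows "Lindelofin X S"
  using assms unfolding Lindelofin_def by simp

lemma LindelofinE:
  assumes "Lindelofin X S" "\<forall>U \<in> \<U>. openin X U" "S \<subseteq> \<Union>\<U>"
  obtains \<V> where "countable \<V>" "\<V> \<subseteq> \<U>" "S \<subseteq> \<Union>\<V>"
  using assms unfolding Lindelofin_def by (elim conjE allE[of _ \<U>]) blast

lemma Lindelofin_continuous_map_image: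
  assumes "continuous_map Y X f" "Lindelofin Y K"
  shows "Lindelofin X (f ` K)"
proof -
  have K: "K \<subseteq> topspace Y" using assms(2) unfolding Lindelofin_def by blast
  let ?pre = "\<lambda>U. {y \<in> topspace Y. f y \<in> U}"
  show ?thesis
  proof (rule LindelofinI)
    show "f ` K \<subseteq> topspace X"
      using K continuous_map_image_subset_topspace[OF assms(1)] by blast
  next
    fix \<U> assume \<U>: "\<forall>U \<in> \<U>. openin X U" "f ` K \<subseteq> \<Union>\<U>"
    have "\<forall>W \<in> ?pre ` \<U>. openin Y W"
      using \<U>(1) openin_continuous_map_preimage[OF assms(1)] by blast
    moreover have "K \<subseteq> \<Union>(?pre ` \<U>)" using \<U>(2) K by blast
    ultimately obtain \<W> where \<W>: "countable \<W>" "\<W> \<subseteq> ?pre ` \<U>" "K \<subseteq> \<Union>\<W>"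
      by (rule LindelofinE[OF assms(2)])
    obtain \<V> where \<V>: "countable \<V>" "\<V> \<subseteq> \<U>" "\<W> = ?pre ` \<V>"
      using iffD1[OF countable_subset_image conjI[OF \<W>(1,2)]] by blast
    have "f ` K \<subseteq> \<Union>\<V>" using \<W>(3) unfolding \<V>(3) by blast
    with \<V>(1,2) show "\<exists>\<V>. countable \<V> \<and> \<V> \<subseteq> \<U> \<and> f ` K \<subseteq> \<Union>\<V>" by blast
  qed
qed

text \<open>A set and its saturation have the same open covers, because the union of a cover is open
  and an open set that contains the set contains its saturation.\<close>

lemma Lindelofin_saturation:
  assumes "Lindelofin X S"
  shows "Lindelofin X (saturation X S)"
proof -
  have S: "S \<subseteq> topspace X" using assms unfolding Lindelofin_def by blast
  have iff: "saturation X S \<subseteq> \<Union>\<U> \<longleftrightarrow> S \<subseteq> \<Union>\<U>" if "\<forall>U \<in> \<U>. openin X U" for \<U>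
    using that by (intro saturation_subset_iff[OF openin_Union S]) simp
  show ?thesis
  proof (rule LindelofinI)
    show "saturation X S \<subseteq> topspace X" unfolding saturation_def by (rule Int_lower1)
  next
    fix \<U> assume \<U>: "\<forall>U \<in> \<U>. openin X U" "saturation X S \<subseteq> \<Union>\<U>"
    have "S \<subseteq> \<Union>\<U>" using \<U>(2) iff[OF \<U>(1)] by simp
    then obtain \<V> where \<V>: "countable \<V>" "\<V> \<subseteq> \<U>" "S \<subseteq> \<Union>\<V>"
      by (rule LindelofinE[OF assms \<U>(1)])
    have "\<forall>U \<in> \<V>. openin X U" using \<U>(1) \<V>(2) by blast
    then have "saturation X S \<subseteq> \<Union>\<V>" using \<V>(3) iff by simp
    with \<V>(1,2) show "\<exists>\<V>. countable \<V> \<and> \<V> \<subseteq> \<U> \<and> saturation X S \<subseteq> \<Union>\<V>" by blast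
  qed
qed

lemma countably_filtered_image:
  assumes "countably_filtered \<K>" "mono f"
  shows "countably_filtered (f ` \<K>)"
  unfolding countably_filtered_def
proof (intro conjI allI impI)
  show "f ` \<K> \<noteq> {}" using assms(1) unfolding countably_filtered_def by blast
next
  fix \<C> assume \<C>: "countable \<C> \<and> \<C> \<subseteq> f ` \<K>"
  obtain \<D> where \<D>: "countable \<D>" "\<D> \<subseteq> \<K>" "\<C> = f ` \<D>"
    using iffD1[OF countable_subset_image \<C>] by blast
  have "\<exists>K \<in> \<K>. \<forall>D \<in> \<D>. K \<subseteq> D"
    using assms(1) \<D>(1,2) unfolding countably_filtered_def by simp
  then obtain K where K: "K \<in> \<K>" "\<And>D. D \<in> \<D> \<Longrightarrow> K \<subseteq> D" by blast
  have "\<forall>C \<in> \<C>. f K \<subseteq> C" unfolding \<D>(3) using K(2) by (simp add: monoD[OF assms(2)])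
  with K(1) show "\<exists>K \<in> f ` \<K>. \<forall>C \<in> \<C>. K \<subseteq> C" by blast
qed

text \<open>Saturating \<open>s ` K\<close> in \<open>X\<close> adds points that need not come from \<open>Y\<close>, but \<open>r\<close> cannot
  tell them apart from \<open>K\<close>: if \<open>V\<close> is an open set containing \<open>K\<close>, its preimage under \<open>r\<close>
  is one of the open sets whose intersection is the saturation.\<close>

lemma saturation_section_image:
  assumes "retraction_maps X Y r s" "saturated_in Y K"
  shows "r ` saturation X (s ` K) \<subseteq> K"
proof
  fix y assume "y \<in> r ` saturation X (s ` K)"
  then obtain x where x: "x \<in> saturation X (s ` K)" and y: "y = r x" by blast
  have r: "continuous_map X Y r" and s: "continuous_map Y X s"
    and rs: "\<And>z. z \<in> topspace Y \<Longrightarrow> r (s z) = z"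
    using assms(1) unfolding retraction_maps_def by auto
  obtain \<V> where \<V>: "\<forall>V \<in> \<V>. openin Y V" and K: "K = topspace Y \<inter> \<Inter>\<V>"
    using assms(2) unfolding saturated_in_def by blast
  have "r x \<in> V" if "V \<in> \<V>" for V
  proof -
    let ?W = "{x \<in> topspace X. r x \<in> V}"
    have "openin X ?W" using openin_continuous_map_preimage[OF r] \<V> that by blast
    moreover have "s ` K \<subseteq> ?W"
      using continuous_map_image_subset_topspace[OF s] rs that unfolding K by auto
    ultimately show ?thesis using x unfolding saturation_def by blast
  qed
  moreover have "r x \<in> topspace Y"
    using x continuous_map_image_subset_topspace[OF r] unfolding saturation_def by blast
  ultimately show "y \<in> K" unfolding y K by blast
qed

theorem proposition3p9:
  fixes X :: "'a topology" and Y :: "'b topology"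
    and r :: "'a \<Rightarrow> 'b" and s :: "'b \<Rightarrow> 'a"
  assumes "c_well_filtered X"
    and "retraction_maps X Y r s"
  shows "c_well_filtered Y"
  unfolding c_well_filtered_def
proof (intro allI impI, elim conjE)
  fix \<K> U
  assume filt: "countably_filtered \<K>"
    and \<K>: "\<forall>K \<in> \<K>. saturated_in Y K \<and> Lindelofin Y K"
    and U: "openin Y U" "\<Inter>\<K> \<subseteq> U"
  have r: "continuous_map X Y r" and s: "continuous_map Y X s"
    and rs: "\<And>z. z \<in> topspace Y \<Longrightarrow> r (s z) = z"
    using assms(2) unfolding retraction_maps_def by auto
  let ?L = "\<lambda>K. saturation X (s ` K)"
  let ?W = "{x \<in> topspace X. r x \<in> U}"
  have "mono ?L" by (intro monoI saturation_mono image_mono)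
  then have "countably_filtered (?L ` \<K>)" by (rule countably_filtered_image[OF filt])
  moreover have "\<forall>L \<in> ?L ` \<K>. saturated_in X L \<and> Lindelofin X L"
    using \<K> by (auto intro!: saturated_in_saturation Lindelofin_saturation
        Lindelofin_continuous_map_image[OF s])
  moreover have W: "openin X ?W" by (rule openin_continuous_map_preimage[OF r U(1)])
  moreover have "\<Inter>(?L ` \<K>) \<subseteq> ?W"
  proof
    fix x assume x: "x \<in> \<Inter>(?L ` \<K>)"
    have "r x \<in> K" if "K \<in> \<K>" for K
      using saturation_section_image[OF assms(2)] \<K> x that by blast
    then have "r x \<in> U" using U(2) by blast
    moreover have "x \<in> topspace X"
      using x filt unfolding countably_filtered_def saturation_def by blast
    ultimately show "x \<in> ?W" by blast
  qed
  ultimately have "\<exists>L \<in> ?L ` \<K>. L \<subseteq> ?W"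
    using assms(1)[unfolded c_well_filtered_def, rule_format, of "?L ` \<K>" ?W] by simp
  then obtain K where K: "K \<in> \<K>" "?L K \<subseteq> ?W" by blast
  have KY: "K \<subseteq> topspace Y" using \<K> K(1) unfolding Lindelofin_def by blast
  then have "s ` K \<subseteq> topspace X" using continuous_map_image_subset_topspace[OF s] by blast
  then have "s ` K \<subseteq> ?W" using K(2) saturation_subset_iff[OF W] by blast
  then have "K \<subseteq> U" using rs KY by force
  with K(1) show "\<exists>K \<in> \<K>. K \<subseteq> U" by blast
qed

end
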